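(* Let $q$ be a power of an odd prime $p$ with $q \equiv 3 \pmod 4$, and let $a \in \mathbb{F}_q^*$. With $P(j,k)$ and $V(j)$ the sums (depending on $a$) defined in the context, the identity $$P(j,k) = V(j)\,V(k)$$ holds for all $j,k \in \mathbb{F}_q$.
   Context: All multiplicative characters are complex-valued and are extended to map $0$ to $0$. $\phi$ denotes the quadratic character on $\mathbb{F}_q$. The additive character $\psi$ on $\mathbb{F}_q$ is $\psi(y) = \exp\big(\frac{2\pi i}{p}(y^p + y^{p^2} + \dots + y^q)\big)$ (the trace to $\mathbb{F}_p$ in the exponent), and $\psi_2$ is the corresponding additive character on $\mathbb{F}_{q^2}$, i.e. $\psi_2(z) = \psi(z+z^q)$. $G(\phi) = \sum_{y \in \mathbb{F}_q} \phi(y)\psi(y)$. $N z = z \cdot z^q \in \mathbb{F}_q$ is the norm of $z \in \mathbb{F}_{q^2}$. $M_8$ is a fixed multiplicative character of order $8$ on $\mathbb{F}_{q^2}$. $\delta(j,k)$ is the Kronecker delta for $j,k \in \mathbb{F}_q$. For $j,k \in \mathbb{F}_q$ define $$P(j,k) = \delta(j,k) + \phi(-1)\delta(j,-k) + \frac{1}{G(\phi)}\sum_{x \in \mathbb{F}_q^*} \phi(a/x - x)\,\psi\big(x(j+k)^2 + (a/x)(j-k)^2\big).$$ Put $\tau = -\sqrt{q M_8(-a)}$, where the choice of square root is fixed, and define $$V(j) = \tau^{-1}\phi(j)\sum_{z \in \mathbb{F}_{q^2},\ Nz = a} M_8(z)\psi_2(j^2 z), \quad j \in \mathbb{F}_q.$$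 *)

theory Defs
  imports "HOL-Analysis.Analysis" "HOL-Computational_Algebra.Primes"
begin

(* The field with q elements is a type 'k and the field with q^2 elements is a type 'K,
   the inclusion being a ring homomorphism emb :: 'k => 'K.  In all definitions q = CARD('k) = p^n. *)

definition field_embedding :: "('k::field \<Rightarrow> 'K::field) \<Rightarrow> bool" where
  "field_embedding emb \<longleftrightarrow> emb 1 = 1 \<and>
     (\<forall>x y. emb (x + y) = emb x + emb y) \<and> (\<forall>x y. emb (x * y) = emb x * emb y)"

definition mult_char :: "('k::{finite,field} \<Rightarrow> complex) \<Rightarrow> bool" where
  "mult_char \<theta> \<longleftrightarrow> \<theta> 0 = 0 \<and> \<theta> 1 = 1 \<and> (\<forall>x y. \<theta> (x * y) = \<theta> x * \<theta> y)"

definition mult_char_order :: "('k::{finite,field} \<Rightarrow> complex) \<Rightarrow> nat" where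
  "mult_char_order \<theta> = (LEAST m. m > 0 \<and> (\<forall>x. x \<noteq> 0 \<longrightarrow> \<theta> x ^ m = 1))"

definition quad_char :: "'k::{finite,field} \<Rightarrow> complex" where
  "quad_char y = (if y = 0 then 0 else if \<exists>x. x^2 = y then 1 else -1)"

(* Meaningful on the prime subfield only; the trace below lies there. *)
definition prime_field_rep :: "nat \<Rightarrow> 'k::{finite,field} \<Rightarrow> nat" where
  "prime_field_rep p t = (THE m. m < p \<and> of_nat m = t)"

definition psi :: "nat \<Rightarrow> nat \<Rightarrow> 'k::{finite,field} \<Rightarrow> complex" where
  "psi p n y = exp (2 * of_real pi * \<i> / of_nat p *
                    of_nat (prime_field_rep p (\<Sum>i=1..n. y ^ (p ^ i))))"

definition gauss_sum :: "nat \<Rightarrow> nat \<Rightarrow> ('k::{finite,field} \<Rightarrow> complex) \<Rightarrow> complex" where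
  "gauss_sum p n \<theta> = (\<Sum>y\<in>UNIV. \<theta> y * psi p n y)"

(* The elements z + z^q and z * z^q lie in the range of emb; inv emb reads them in 'k. *)
definition psi2 :: "nat \<Rightarrow> nat \<Rightarrow> ('k::{finite,field} \<Rightarrow> 'K::{finite,field}) \<Rightarrow> 'K \<Rightarrow> complex" where
  "psi2 p n emb z = psi p n (inv emb (z + z ^ CARD('k)))"

definition field_norm :: "('k::{finite,field} \<Rightarrow> 'K::{finite,field}) \<Rightarrow> 'K \<Rightarrow> 'k" where
  "field_norm emb z = inv emb (z * z ^ CARD('k))"

definition kdelta :: "'k \<Rightarrow> 'k \<Rightarrow> complex" where
  "kdelta j k = (if j = k then 1 else 0)"

definition P_sum :: "nat \<Rightarrow> nat \<Rightarrow> 'k::{finite,field} \<Rightarrow> 'k \<Rightarrow> 'k \<Rightarrow> complex" where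
  "P_sum p n a j k = kdelta j k + quad_char (-1 :: 'k) * kdelta j (- k) +
     1 / gauss_sum p n (quad_char :: 'k \<Rightarrow> complex) *
     (\<Sum>x\<in>UNIV - {0}. quad_char (a / x - x) * psi p n (x * (j + k)^2 + (a / x) * (j - k)^2))"

definition V_sum :: "nat \<Rightarrow> nat \<Rightarrow> ('k::{finite,field} \<Rightarrow> 'K::{finite,field}) \<Rightarrow> ('K \<Rightarrow> complex) \<Rightarrow>
                 complex \<Rightarrow> 'k \<Rightarrow> 'k \<Rightarrow> complex" where
  "V_sum p n emb M8 \<tau> a j = inverse \<tau> * quad_char j *
     (\<Sum>z | field_norm emb z = a. M8 z * psi2 p n emb ((emb j)^2 * z))"

end

theory Submission
  imports Defs "HOL-Computational_Algebra.Polynomial" "HOL-Number_Theory.Cong"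
begin

text \<open>
  Since \<open>q \<equiv> 3 (mod 4)\<close>, the element \<open>-1\<close> is not a square in the small field, so the large field
  is obtained by adjoining \<open>i\<close> with \<open>i\<^sup>2 = -1\<close>, conjugation \<open>z \<mapsto> z\<^sup>q\<close> sends \<open>x + i y\<close> to \<open>x - i y\<close>,
  and the norm is \<open>x\<^sup>2 + y\<^sup>2\<close>. Both sides of the identity are reduced to one and the same sum
  \<open>W = \<Sum>\<^sub>r \<phi>(2jk + r) K(a((j\<^sup>2 + k\<^sup>2)\<^sup>2 - r\<^sup>2))\<close>, where \<open>K(b) = \<Sum>\<^sub>x \<psi>(x + b/x)\<close> is a Kloosterman sum.

  On the side of \<open>P\<close>, the exponent is \<open>(x + a/x)(j\<^sup>2 + k\<^sup>2) + (x - a/x) 2jk\<close>. The factor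
  \<open>\<phi>(a/x - x) \<psi>((x - a/x) 2jk)\<close> is a translated Gauss sum divided by \<open>G(\<phi>)\<close>; inserting that sum
  and summing over \<open>x\<close> first leaves Kloosterman sums, and \<open>G(\<phi>)\<^sup>2 = -q\<close> gives the constant
  (\<open>gauss_times_twisted_sum\<close>).

  On the side of \<open>V\<close>, the product is a double sum over elements \<open>z, w\<close> of norm \<open>a\<close>. Writing
  \<open>w = z\<^sup>q t\<close> with \<open>t\<close> of norm \<open>1\<close> separates the multiplicative character \<open>M\<^sub>8\<close>, which then only
  sees \<open>a t\<close>, from a sum of \<open>\<psi>\<^sub>2\<close> over the elements of norm \<open>a\<close> (\<open>norm_sum_product\<close>). The
  latter is \<open>-K(a N(c))\<close> with \<open>c = j\<^sup>2 + k\<^sup>2 t\<^sup>q\<close>, because the numbers of elements of trace \<open>s\<close> on the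
  torus \<open>N z = b\<close> and of points with \<open>x + b/x = s\<close> add up to \<open>2\<close>; the exceptional value \<open>c = 0\<close>,
  which needs \<open>t = -1\<close> and \<open>j = \<plusminus>k\<close>, produces the Kronecker deltas (\<open>sum_norm_scaled\<close>).
  It remains to evaluate \<open>\<Sum> M\<^sub>8(t) F(tr t)\<close> over the norm-one group. There \<open>M\<^sub>8\<close> is a quartic character,
  so that \<open>t\<close> and \<open>1/t\<close> cancel unless \<open>t = u\<^sup>2\<close> with \<open>N u = 1\<close>; and \<open>M\<^sub>8(u)\<^sup>2 = \<phi>(2 + tr u)\<close> because
  \<open>u = (1 + u)\<^sup>1\<^sup>-\<^sup>q\<close> and \<open>M\<^sub>8\<^sup>4\<close> is the quadratic character. This turns the sum into
  \<open>\<Sum>\<^sub>s \<phi>(2 + s) F(s\<^sup>2 - 2)\<close> (\<open>sum_norm_one\<close>), and \<open>r = jk s\<close> gives \<open>W\<close>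
  when \<open>jk \<noteq> 0\<close>. If \<open>jk = 0\<close>, both sides of the identity vanish.
\<close>

section \<open>The quadratic character of a finite field\<close>

lemma fermat_finite_field_unit:
  fixes x :: "'k::{finite,field}"
  assumes "x \<noteq> 0"
  shows "x ^ (CARD('k) - 1) = 1"
proof -
  have "(\<Prod>y\<in>UNIV - {0}. x * y) = (\<Prod>y\<in>UNIV - {0}. y)"
    by (rule prod.reindex_bij_witness[of _ "\<lambda>y. y / x" "\<lambda>y. x * y"]) (use assms in auto)
  hence "x ^ (CARD('k) - 1) * (\<Prod>y\<in>UNIV - {0}. y) = (\<Prod>y\<in>UNIV - {0::'k}. y)"
    by (simp add: prod.distrib)
  moreover have "(\<Prod>y\<in>UNIV - {0::'k}. y) \<noteq> 0" by (simp add: prod_zero_iff)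
  ultimately show ?thesis by (metis mult_cancel_right2)
qed

lemma fermat_finite_field:
  fixes x :: "'k::{finite,field}"
  shows "x ^ CARD('k) = x"
proof (cases "x = 0")
  case False
  have "x ^ CARD('k) = x * x ^ (CARD('k) - 1)"
    by (simp add: finite_UNIV_card_ge_0 flip: power_Suc)
  with fermat_finite_field_unit[OF False] show ?thesis by simp
qed simp

lemma CHAR_finite_field:
  assumes "prime p" and "CARD('k::{finite,field}) = p ^ n"
  shows "CHAR('k) = p"
proof -
  have "(\<Sum>x\<in>(UNIV::'k set). x + 1) = (\<Sum>x\<in>UNIV. x)"
    by (rule sum.reindex_bij_witness[of _ "\<lambda>x. x - 1" "\<lambda>x. x + 1"]) auto
  hence "of_nat CARD('k) = (0 :: 'k)"
    by (simp add: sum.distrib)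
  hence "of_nat p ^ n = (0 :: 'k)"
    by (simp add: assms(2))
  hence "of_nat p = (0 :: 'k)"
    by simp
  hence "CHAR('k) dvd p"
    by (simp add: of_nat_eq_0_iff_char_dvd)
  moreover have "CHAR('k) \<noteq> 1"
    by (metis of_nat_1 of_nat_CHAR zero_neq_one)
  ultimately show ?thesis
    using assms(1) by (auto simp: prime_nat_iff)
qed

lemma card_quadratic_roots:
  fixes y :: "'k::{finite,field}"
  assumes "(2::'k) \<noteq> 0"
  shows "of_nat (card {x. x\<^sup>2 = y}) = 1 + quad_char y"
proof (cases "\<exists>x. x\<^sup>2 = y")
  case True
  then obtain r where r: "r\<^sup>2 = y" by blast
  have set: "{x. x\<^sup>2 = y} = {r, - r}"
    using r by (auto simp: power2_eq_iff)
  have "r = - r \<longleftrightarrow> r = 0"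
    using assms by (metis add.inverse_neutral add_eq_0_iff mult_2 mult_eq_0_iff)
  with r True show ?thesis
    unfolding set by (auto simp: quad_char_def)
qed (auto simp: quad_char_def)

lemma quad_char_0 [simp]: "quad_char 0 = 0"
  and quad_char_square: "y \<noteq> 0 \<Longrightarrow> quad_char (y\<^sup>2) = 1"
  and quad_char_power2: "y \<noteq> 0 \<Longrightarrow> quad_char y ^ 2 = 1"
  by (auto simp: quad_char_def)

lemma quad_char_1 [simp]: "quad_char 1 = 1"
  using quad_char_square[of 1] by simp

lemma sum_quad_char:
  assumes "(2::'k::{finite,field}) \<noteq> 0"
  shows "(\<Sum>y\<in>(UNIV::'k set). quad_char y) = 0"
proof -
  have "(\<Sum>y\<in>(UNIV::'k set). of_nat (card {x. x\<^sup>2 = y}) * 1) = (\<Sum>x\<in>(UNIV::'k set). 1::complex)"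
    using sum_fun_comp[of "UNIV::'k set" UNIV "\<lambda>x. x\<^sup>2" "\<lambda>_. 1 :: complex"] by simp
  thus ?thesis
    by (simp add: card_quadratic_roots[OF assms] sum.distrib)
qed

text \<open>
  A function with values \<open>\<plusminus>1\<close> that is \<open>1\<close> on squares dominates the quadratic character
  pointwise; as both sum to zero, they agree. This replaces any use of a generator of the
  multiplicative group.
\<close>
lemma quad_char_eqI:
  fixes f :: "'k::{finite,field} \<Rightarrow> complex"
  assumes two: "(2::'k) \<noteq> 0"
    and f0: "f 0 = 0" and pm: "\<And>y. y \<noteq> 0 \<Longrightarrow> f y = 1 \<or> f y = -1"
    and sq: "\<And>y. y \<noteq> 0 \<Longrightarrow> f (y\<^sup>2) = 1"
    and sum: "(\<Sum>y\<in>UNIV. f y) = 0"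
  shows "f = quad_char"
proof
  fix z
  have nonneg: "Re (f y - quad_char y) \<ge> 0 \<and> Im (f y - quad_char y) = 0" for y
    using pm[of y] sq f0 by (auto simp: quad_char_def)
  have "(\<Sum>y\<in>UNIV. Re (f y - quad_char y)) = 0"
    using sum sum_quad_char[OF two] by (simp add: sum_subtractf flip: Re_sum)
  hence "\<forall>y\<in>UNIV. Re (f y - quad_char y) = 0"
    by (subst (asm) sum_nonneg_eq_0_iff) (use nonneg in auto)
  thus "f z = quad_char z"
    using nonneg[of z] by (auto simp: complex_eq_iff)
qed

text \<open>
  For a non-square \<open>y\<close>, the function \<open>x \<mapsto> - \<phi>(x y)\<close> satisfies the criterion above.
\<close>
lemma quad_char_mult:
  fixes x y :: "'k::{finite,field}"
  assumes two: "(2::'k) \<noteq> 0"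
  shows "quad_char (x * y) = quad_char x * quad_char y"
proof (cases "y = 0")
  case False
  show ?thesis
  proof (cases "\<exists>r. r\<^sup>2 = y")
    case True
    then obtain r where r: "r\<^sup>2 = y" "r \<noteq> 0" using False by auto
    have "(\<exists>s. s\<^sup>2 = x * y) \<longleftrightarrow> (\<exists>s. s\<^sup>2 = x)"
    proof
      assume "\<exists>s. s\<^sup>2 = x * y"
      then obtain s where "s\<^sup>2 = x * y" by blast
      hence "(s / r)\<^sup>2 = x" using r False by (simp add: power_divide)
      thus "\<exists>s. s\<^sup>2 = x" ..
    next
      assume "\<exists>s. s\<^sup>2 = x"
      thus "\<exists>s. s\<^sup>2 = x * y" using r by (metis power_mult_distrib)
    qed
    with True False show ?thesis by (auto simp: quad_char_def)
  next
    case nonsq: False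
    have "(\<lambda>x. - quad_char (x * y)) = quad_char"
    proof (rule quad_char_eqI[OF two])
      fix r :: 'k assume r: "r \<noteq> 0"
      have "\<not> (\<exists>s. s\<^sup>2 = r\<^sup>2 * y)"
      proof
        assume "\<exists>s. s\<^sup>2 = r\<^sup>2 * y"
        then obtain s where "s\<^sup>2 = r\<^sup>2 * y" by blast
        hence "(s / r)\<^sup>2 = y" using r by (simp add: power_divide)
        with nonsq show False by blast
      qed
      thus "- quad_char (r\<^sup>2 * y) = 1"
        using r False by (auto simp: quad_char_def)
    next
      have "(\<Sum>x\<in>UNIV. quad_char (x * y)) = (\<Sum>x\<in>(UNIV::'k set). quad_char x)"
        by (rule sum.reindex_bij_witness[of _ "\<lambda>x. x / y" "\<lambda>x. x * y"]) (use False in auto)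
      thus "(\<Sum>x\<in>UNIV. - quad_char (x * y)) = 0"
        by (simp add: sum_quad_char[OF two] sum_negf)
    qed (use False in \<open>auto simp: quad_char_def\<close>)
    hence "- quad_char (x * y) = quad_char x" by (rule fun_cong)
    hence "quad_char (x * y) = - quad_char x" by (metis minus_minus)
    moreover have "quad_char y = -1" using nonsq False by (auto simp: quad_char_def)
    ultimately show ?thesis by simp
  qed
qed simp

text \<open>
  A nontrivial character sums to zero, so the quadratic character is the only one of order two.
\<close>
lemma mult_char_eq_quad_char:
  fixes \<theta> :: "'k::{finite,field} \<Rightarrow> complex"
  assumes two: "(2::'k) \<noteq> 0" and \<theta>: "mult_char \<theta>"
    and sq: "\<And>x. x \<noteq> 0 \<Longrightarrow> \<theta> x ^ 2 = 1" and c: "c \<noteq> 0" "\<theta> c \<noteq> 1"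
  shows "\<theta> = quad_char"
proof (rule quad_char_eqI[OF two])
  have mult: "\<theta> (x * y) = \<theta> x * \<theta> y" for x y
    using \<theta> by (simp add: mult_char_def)
  show "\<theta> 0 = 0" using \<theta> by (simp add: mult_char_def)
  show "\<theta> y = 1 \<or> \<theta> y = -1" if "y \<noteq> 0" for y
    using sq[OF that] by (simp add: power2_eq_1_iff)
  show "\<theta> (y\<^sup>2) = 1" if "y \<noteq> 0" for y
    using sq[OF that] by (simp add: power2_eq_square mult)
  have "(\<Sum>y\<in>UNIV. \<theta> y) = (\<Sum>y\<in>UNIV. \<theta> (c * y))"
    by (rule sum.reindex_bij_witness[of _ "\<lambda>x. c * x" "\<lambda>x. x / c"]) (use c in auto)
  also have "\<dots> = \<theta> c * (\<Sum>y\<in>UNIV. \<theta> y)"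
    by (simp add: mult sum_distrib_left)
  finally show "(\<Sum>y\<in>UNIV. \<theta> y) = 0"
    using c by simp
qed

section \<open>The canonical additive character\<close>

lemma psi_eq_root_of_unity_power:
  "psi p n y = exp (2 * of_real pi * \<i> / of_nat p) ^
                 prime_field_rep p (\<Sum>i=1..n. y ^ (p ^ i))"
  by (simp add: psi_def mult_ac flip: exp_of_nat_mult)

text \<open>
  The roots of \<open>t\<^sup>p - t\<close> are exactly the multiples of \<open>1\<close>: there are at most \<open>p\<close> roots, and the
  multiples already provide \<open>p\<close> of them.
\<close>
lemma of_nat_prime_field_rep:
  fixes t :: "'k::{finite,field}"
  assumes p: "prime p" and char: "CHAR('k) = p" and t: "t ^ p = t"
  shows "prime_field_rep p t < p" and "of_nat (prime_field_rep p t) = t"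
proof -
  let ?R = "{t::'k. t ^ p = t}" and ?P = "monom 1 p - monom 1 1 :: 'k poly"
  have p1: "p > 1" using p by (rule prime_gt_1_nat)
  have "coeff ?P p = 1" using p1 by simp
  hence nz: "?P \<noteq> 0" by (metis coeff_0 zero_neq_one)
  have "?R = {t. poly ?P t = 0}" by (auto simp: poly_monom)
  hence "card ?R \<le> degree ?P" using card_poly_roots_bound[OF nz] by simp
  also have "\<dots> \<le> p" using p1 by (intro degree_diff_le) (auto simp: degree_monom_eq)
  finally have le: "card ?R \<le> p" .
  have pc: "prime CHAR('k)" using p char by simp
  have "of_nat m ^ p = (of_nat m :: 'k)" for m
    by (induction m) (use freshmans_dream[OF pc, of p] char p1 in \<open>auto simp: power_0_left\<close>)
  hence sub: "of_nat ` {..<p} \<subseteq> ?R" by auto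
  have inj: "inj_on (of_nat :: nat \<Rightarrow> 'k) {..<p}"
    by (auto simp: inj_on_def of_nat_eq_iff_cong_CHAR char cong_less_modulus_unique_nat)
  hence "card (of_nat ` {..<p} :: 'k set) = p" by (simp add: card_image)
  hence "of_nat ` {..<p} = ?R"
    using le sub by (intro card_seteq) auto
  with t have "t \<in> of_nat ` {..<p}" by blast
  then obtain m where m: "m < p" "of_nat m = t" by auto
  have "prime_field_rep p t = m"
    unfolding prime_field_rep_def using m inj
    by (intro the_equality) (auto simp: inj_on_def)
  thus "prime_field_rep p t < p" and "of_nat (prime_field_rep p t) = t"
    using m by auto
qed

text \<open>The vanishing of the total sum stands for nontriviality.\<close>
locale additive_character =
  fixes \<psi> :: "'k::{finite,field} \<Rightarrow> complex"
  assumes add: "\<psi> (x + y) = \<psi> x * \<psi> y"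
    and zero [simp]: "\<psi> 0 = 1"
    and sum_eq_0: "(\<Sum>x\<in>UNIV. \<psi> x) = 0"

text \<open>
  Additivity is the Frobenius identity. Since \<open>y\<^sup>q = y\<close>, the trace is a polynomial function of
  degree at most \<open>p\<^sup>n\<^sup>-\<^sup>1 < q\<close>, hence not identically zero; so the character is nontrivial and sums to zero.
\<close>
lemma additive_character_psi:
  assumes p: "prime p" and card: "CARD('k::{finite,field}) = p ^ n"
  shows "additive_character (psi p n :: 'k \<Rightarrow> complex)"
proof -
  let ?t = "\<lambda>y::'k. \<Sum>i=1..n. y ^ (p ^ i)" and ?w = "exp (2 * of_real pi * \<i> / of_nat p) :: complex"
  have char: "CHAR('k) = p" by (rule CHAR_finite_field[OF p card])
  hence pc: "prime CHAR('k)" using p by simp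
  have p1: "p > 1" using p by (rule prime_gt_1_nat)
  have yq: "y ^ (p ^ n) = y" for y :: 'k
    using fermat_finite_field[of y] card by simp
  have n0: "n > 0"
  proof (rule ccontr)
    assume "\<not> n > 0"
    hence "CARD('k) = 1" using card by simp
    moreover have "card {0, 1::'k} \<le> CARD('k)" by (intro card_mono) auto
    ultimately show False by simp
  qed
  have t_pow: "?t y ^ p = ?t y" for y
  proof -
    have "?t y ^ p = (\<Sum>i=1..n. y ^ (p ^ Suc i))"
      using pc char by (subst freshmans_dream_sum) (auto simp: mult_ac simp flip: power_mult)
    also have "\<dots> = (\<Sum>i=Suc 1..Suc n. y ^ (p ^ i))"
      by (simp only: sum.shift_bounds_cl_Suc_ivl)
    also have "\<dots> + y ^ p = (\<Sum>i=1..Suc n. y ^ (p ^ i))"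
      by (subst (2) sum.atLeast_Suc_atMost) (auto simp: add_ac)
    also have "\<dots> = ?t y + (y ^ (p ^ n)) ^ p"
      by (simp add: mult_ac flip: power_mult)
    finally show ?thesis by (simp add: yq)
  qed
  have t_add: "?t (x + y) = ?t x + ?t y" for x y
    by (simp add: freshmans_dream'[OF pc] char sum.distrib)
  have wp: "?w ^ p = 1"
    using p1 by (simp flip: exp_of_nat_mult)
  have w_mod: "?w ^ (m mod p) = ?w ^ m" for m
  proof -
    have "?w ^ m = ?w ^ (p * (m div p) + m mod p)" by simp
    also have "\<dots> = ?w ^ (m mod p)" by (simp only: power_add power_mult wp) simp
    finally show ?thesis ..
  qed
  note rep = of_nat_prime_field_rep[OF p char t_pow]
  have psi_add: "psi p n (x + y) = psi p n x * psi p n y" for x y :: 'k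
  proof -
    have "of_nat (prime_field_rep p (?t (x + y))) =
            (of_nat (prime_field_rep p (?t x) + prime_field_rep p (?t y)) :: 'k)"
      by (simp only: of_nat_add rep(2)) (rule t_add)
    hence "prime_field_rep p (?t (x + y)) mod p =
             (prime_field_rep p (?t x) + prime_field_rep p (?t y)) mod p"
      by (simp only: of_nat_eq_iff_cong_CHAR char cong_def)
    thus ?thesis
      unfolding psi_eq_root_of_unity_power by (metis w_mod power_add)
  qed
  let ?Q = "\<Sum>i<n. monom 1 (p ^ i) :: 'k poly"
  have t_Q: "poly ?Q y = ?t y" for y
  proof -
    obtain m where m: "n = Suc m" using n0 gr0_implies_Suc by blast
    have "?t y = (\<Sum>i<n. y ^ (p ^ Suc i))"
      by (rule sum.reindex_bij_witness[of _ Suc "\<lambda>i. i - 1"]) auto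
    also have "\<dots> = (\<Sum>i<m. y ^ (p ^ Suc i)) + y ^ (p ^ n)" by (simp add: m)
    also have "\<dots> = (\<Sum>i<Suc m. y ^ (p ^ i))"
      unfolding sum.lessThan_Suc_shift by (simp add: yq)
    finally show ?thesis by (simp add: poly_sum poly_monom m)
  qed
  have "coeff ?Q 1 = (\<Sum>i<n. if i = 0 then 1 else 0)"
    using p1 by (intro trans[OF coeff_sum] sum.cong) auto
  also have "\<dots> = 1" using n0 by simp
  finally have Q_nz: "?Q \<noteq> 0" by (metis coeff_0 zero_neq_one)
  have "degree ?Q \<le> p ^ (n - 1)"
    using p1 by (intro degree_sum_le) (auto simp: degree_monom_eq intro!: power_increasing)
  also have "\<dots> < p ^ n" using p1 n0 by simp
  finally have "card {y. poly ?Q y = 0} < CARD('k)"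
    using card_poly_roots_bound[OF Q_nz] card by simp
  hence "{y. poly ?Q y = 0} \<noteq> UNIV" by auto
  then obtain c where c: "?t c \<noteq> 0" by (auto simp: t_Q)
  hence "prime_field_rep p (?t c) \<noteq> 0" using rep(2)[of c] by (metis of_nat_0)
  hence "\<not> p dvd prime_field_rep p (?t c)" using rep(1)[of c] by (auto dest: dvd_imp_le)
  hence psi_c: "psi p n c \<noteq> 1"
    using p1 complex_root_unity_eq_1[of p "prime_field_rep p (?t c)"]
    by (simp add: psi_def mult_ac)
  have "psi p n (0::'k) = psi p n (0::'k) * psi p n (0::'k)" using psi_add[of 0 0] by (simp only: add_0_left)
  moreover have "psi p n (0::'k) \<noteq> 0" by (simp add: psi_def)
  ultimately have psi_0: "psi p n (0::'k) = 1" by (metis mult_cancel_right1)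
  have "(\<Sum>x\<in>(UNIV::'k set). psi p n x) = (\<Sum>x\<in>UNIV. psi p n (c + x))"
    by (rule sum.reindex_bij_witness[of _ "\<lambda>x. c + x" "\<lambda>x. x - c"]) auto
  also have "\<dots> = psi p n c * (\<Sum>x\<in>(UNIV::'k set). psi p n x)"
    by (simp add: psi_add sum_distrib_left)
  finally have "(\<Sum>x\<in>(UNIV::'k set). psi p n x) = 0" using psi_c by simp
  with psi_add psi_0 show ?thesis unfolding additive_character_def by blast
qed

section \<open>Gauss and Kloosterman sums\<close>

text \<open>
  The points with \<open>x + b/x = s\<close> are the roots of \<open>X\<^sup>2 - s X + b\<close>, so the quadratic character of
  the discriminant counts them. Compare \<open>sum_norm_fibre_by_trace\<close> below, where the same
  discriminant occurs with the opposite sign.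
\<close>
lemma sum_hyperbola_by_trace:
  fixes f :: "'k::{finite,field} \<Rightarrow> complex"
  assumes two: "(2::'k) \<noteq> 0" and b: "b \<noteq> 0"
  shows "(\<Sum>x\<in>UNIV - {0}. f (x + b / x)) = (\<Sum>s\<in>UNIV. f s * (1 + quad_char (s\<^sup>2 - 4 * b)))"
proof -
  have "card {x \<in> UNIV - {0}. x + b / x = s} = card {y. y\<^sup>2 = s\<^sup>2 - 4 * b}" for s
  proof (rule bij_betw_same_card[of "\<lambda>x. 2 * x - s"], rule bij_betw_byWitness[of _ "\<lambda>y. (y + s) / 2"])
    have *: "x \<noteq> 0 \<Longrightarrow> x + b / x = s \<longleftrightarrow> x * x + b = s * x" for x
      by (simp add: field_simps)
    show "(\<lambda>x. 2 * x - s) ` {x \<in> UNIV - {0}. x + b / x = s} \<subseteq> {y. y\<^sup>2 = s\<^sup>2 - 4 * b}"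
    proof (intro image_subsetI CollectI)
      fix x assume x: "x \<in> {x \<in> UNIV - {0}. x + b / x = s}"
      hence "x * x + b = s * x" using * by blast
      thus "(2 * x - s)\<^sup>2 = s\<^sup>2 - 4 * b" by algebra
    qed
    have four: "(4::'k) \<noteq> 0"
      using two by (metis mult_2 mult_eq_0_iff numeral_Bit0)
    have nz: "(y + s) / 2 \<noteq> 0 \<and> (y + s) / 2 + b / ((y + s) / 2) = s"
      if "y\<^sup>2 = s\<^sup>2 - 4 * b" for y
    proof -
      have y: "(y + s) * (s - y) = 4 * b" using that by (simp add: algebra_simps power2_eq_square)
      hence nz: "(y + s) / 2 \<noteq> 0" using b four two by auto
      define x where "x = (y + s) / 2"
      have "2 * x = y + s" using two by (simp add: x_def del: distrib_left_numeral)
      hence "y = 2 * x - s" by simp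
      hence "4 * (x * x + b) = 4 * (s * x)" using y by algebra
      hence "x * x + b = s * x" using four mult_left_cancel by blast
      thus ?thesis using nz *[of x] unfolding x_def by blast
    qed
    show "(\<lambda>y. (y + s) / 2) ` {y. y\<^sup>2 = s\<^sup>2 - 4 * b} \<subseteq> {x \<in> UNIV - {0}. x + b / x = s}"
    proof (intro image_subsetI)
      fix y assume "y \<in> {y. y\<^sup>2 = s\<^sup>2 - 4 * b}"
      hence "y\<^sup>2 = s\<^sup>2 - 4 * b" by simp
      from nz[OF this] show "(y + s) / 2 \<in> {x \<in> UNIV - {0}. x + b / x = s}"
        unfolding mem_Collect_eq Diff_iff singleton_iff by simp
    qed
    show "\<forall>y\<in>{y. y\<^sup>2 = s\<^sup>2 - 4 * b}. 2 * ((y + s) / 2) - s = y"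
      using two by (simp del: distrib_left_numeral)
  qed (use two in simp)
  hence "of_nat (card {x \<in> UNIV - {0}. x + b / x = s}) = 1 + quad_char (s\<^sup>2 - 4 * b)" for s
    by (simp add: card_quadratic_roots[OF two])
  thus ?thesis
    using sum_fun_comp[of "UNIV - {0}" UNIV "\<lambda>x. x + b / x" f] by (simp add: mult.commute)
qed

locale odd_additive_character = additive_character \<psi>
  for \<psi> :: "'k::{finite,field} \<Rightarrow> complex" +
  assumes two: "(2::'k) \<noteq> 0"
begin

definition gauss :: complex where
  "gauss = (\<Sum>y\<in>UNIV. quad_char y * \<psi> y)"

definition kloosterman :: "'k \<Rightarrow> complex" where
  "kloosterman b = (\<Sum>x\<in>UNIV - {0}. \<psi> (x + b / x))"

lemma sum_scaled: "(\<Sum>x\<in>UNIV. \<psi> (c * x)) = (if c = 0 then of_nat CARD('k) else 0)"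
proof (cases "c = 0")
  case False
  have "(\<Sum>x\<in>UNIV. \<psi> (c * x)) = (\<Sum>x\<in>UNIV. \<psi> x)"
    by (rule sum.reindex_bij_witness[of _ "\<lambda>x. x / c" "\<lambda>x. c * x"]) (use False in auto)
  with False sum_eq_0 show ?thesis by simp
qed simp

lemma sum_nonzero: "(\<Sum>x\<in>UNIV - {0}. \<psi> x) = -1"
  using sum_eq_0 by (simp add: sum_diff1)

lemma kloosterman_0: "kloosterman 0 = -1"
  by (simp add: kloosterman_def sum_nonzero)

lemma kloosterman_rescale:
  assumes c: "c \<noteq> 0"
  shows "(\<Sum>x\<in>UNIV - {0}. \<psi> (x * c + b / x)) = kloosterman (b * c)"
  unfolding kloosterman_def
  by (rule sum.reindex_bij_witness[of _ "\<lambda>x. x / c" "\<lambda>x. x * c"]) (use c in auto)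

lemma gauss_twist: "(\<Sum>y\<in>UNIV. quad_char y * \<psi> (c * y)) = quad_char c * gauss"
proof (cases "c = 0")
  case True
  thus ?thesis by (simp add: sum_quad_char[OF two])
next
  case False
  have inv: "quad_char c * quad_char c = 1" if "c \<noteq> 0" for c :: 'k
    using quad_char_power2[OF that] by (simp add: power2_eq_square)
  have "quad_char c * gauss = quad_char c * (\<Sum>y\<in>UNIV. quad_char (c * y) * \<psi> (c * y))"
    unfolding gauss_def
    by (intro arg_cong[of _ _ "\<lambda>x. quad_char c * x"] 
      sum.reindex_bij_witness[of _ "\<lambda>x. c * x" "\<lambda>x. x / c"]) (use False in auto)
  also have "\<dots> = (quad_char c * quad_char c) * (\<Sum>y\<in>UNIV. quad_char y * \<psi> (c * y))"
    by (simp add: quad_char_mult[OF two] sum_distrib_left mult_ac)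
  finally show ?thesis using inv[OF False] by simp
qed

text \<open>
  This expresses \<open>\<phi>(-c) \<psi>(c u)\<close> as a sum of additive characters in \<open>c\<close>, which is how the
  quadratic character is removed from the sum defining \<open>P\<close>.
\<close>
lemma gauss_shift:
  "(\<Sum>r\<in>UNIV. quad_char (u + r) * \<psi> (- (c * r))) = quad_char (- c) * \<psi> (c * u) * gauss"
proof -
  have "(\<Sum>r\<in>UNIV. quad_char (u + r) * \<psi> (- (c * r))) =
          (\<Sum>y\<in>UNIV. quad_char y * \<psi> (- c * y) * \<psi> (c * u))"
    by (rule sum.reindex_bij_witness[of _ "\<lambda>y. y - u" "\<lambda>r. u + r"])
       (auto simp: algebra_simps simp flip: add)
  also have "\<dots> = (\<Sum>y\<in>UNIV. quad_char y * \<psi> (- c * y)) * \<psi> (c * u)"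
    by (simp add: sum_distrib_right)
  finally show ?thesis by (simp only: gauss_twist) simp
qed

lemma gauss_square: "gauss\<^sup>2 = quad_char (-1 :: 'k) * of_nat CARD('k)"
proof -
  have "gauss\<^sup>2 = (\<Sum>x\<in>UNIV. \<psi> x * (quad_char x * gauss))"
    by (simp add: power2_eq_square gauss_def sum_distrib_left sum_distrib_right mult_ac)
  also have "\<dots> = (\<Sum>x\<in>UNIV. \<Sum>y\<in>UNIV. quad_char y * (\<psi> x * \<psi> (x * y)))"
    by (intro sum.cong refl) (simp only: gauss_twist[symmetric] sum_distrib_left, simp add: mult_ac)
  also have "\<dots> = (\<Sum>y\<in>UNIV. \<Sum>x\<in>UNIV. quad_char y * (\<psi> x * \<psi> (x * y)))"
    by (rule sum.swap)
  also have "\<dots> = (\<Sum>y\<in>UNIV. quad_char y * (\<Sum>x\<in>UNIV. \<psi> ((1 + y) * x)))"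
    by (simp add: sum_distrib_left algebra_simps add)
  also have "\<dots> = (\<Sum>y\<in>(UNIV::'k set). if y = -1 then quad_char y * of_nat CARD('k) else 0)"
    by (intro sum.cong refl) (auto simp: sum_scaled add_eq_0_iff)
  finally show ?thesis by simp
qed

text \<open>
  If \<open>r = u\<close>, both sides degenerate to a sum of \<open>\<psi>\<close> over all nonzero elements.
\<close>
lemma kloosterman_product_form:
  assumes u: "u \<noteq> 0" and a: "a \<noteq> 0"
  shows "(\<Sum>x\<in>UNIV - {0}. \<psi> (x * (u - r) + (a / x) * (u + r))) = kloosterman (a * (u\<^sup>2 - r\<^sup>2))"
    (is "?S = _")
proof (cases "u = r")
  case False
  have "?S = (\<Sum>x\<in>UNIV - {0}. \<psi> (x * (u - r) + (a * (u + r)) / x))"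
    by simp
  also have "\<dots> = kloosterman (a * (u + r) * (u - r))"
    using False by (intro kloosterman_rescale) auto
  finally show ?thesis by (simp add: power2_eq_square algebra_simps)
next
  case True
  have "2 * u * a \<noteq> 0" using u two a by simp
    hence "(\<Sum>x\<in>UNIV - {0}. \<psi> (2 * u * a / x)) = (\<Sum>x\<in>UNIV - {0}. \<psi> x)"
      by (intro sum.reindex_bij_witness[of _ "\<lambda>x. 2 * u * a / x" "\<lambda>x. 2 * u * a / x"])
         (use u a two in auto)
    with True show ?thesis
      by (simp add: sum_nonzero kloosterman_0 mult_ac flip: mult_2)
  qed

text \<open>
  The exponent equals \<open>(x + a/x)(j\<^sup>2 + k\<^sup>2) + (x - a/x) 2jk\<close>, so \<open>gauss_shift\<close> applies with
  \<open>c = x - a/x\<close>, and the resulting exponent is linear in \<open>x\<close> and \<open>a/x\<close> again.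
\<close>
lemma gauss_times_twisted_sum:
  assumes a: "a \<noteq> 0" and u: "j\<^sup>2 + k\<^sup>2 \<noteq> 0"
  shows "gauss * (\<Sum>x\<in>UNIV - {0}. quad_char (a / x - x) * \<psi> (x * (j + k)\<^sup>2 + (a / x) * (j - k)\<^sup>2)) =
           (\<Sum>r\<in>UNIV. quad_char (2 * j * k + r) * kloosterman (a * ((j\<^sup>2 + k\<^sup>2)\<^sup>2 - r\<^sup>2)))"
proof -
  let ?u = "j\<^sup>2 + k\<^sup>2" and ?v = "2 * j * k"
  have "gauss * (quad_char (a / x - x) * \<psi> (x * (j + k)\<^sup>2 + (a / x) * (j - k)\<^sup>2)) =
          (\<Sum>r\<in>UNIV. quad_char (?v + r) * \<psi> (x * (?u - r) + (a / x) * (?u + r)))" for x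
  proof -
    have "x * (j + k)\<^sup>2 + (a / x) * (j - k)\<^sup>2 = (x + a / x) * ?u + (x - a / x) * ?v"
      by (simp add: algebra_simps power2_eq_square)
    hence "gauss * (quad_char (a / x - x) * \<psi> (x * (j + k)\<^sup>2 + (a / x) * (j - k)\<^sup>2)) =
             \<psi> ((x + a / x) * ?u) * (quad_char (- (x - a / x)) * \<psi> ((x - a / x) * ?v) * gauss)"
      by (simp add: add)
    also have "\<dots> = (\<Sum>r\<in>UNIV. quad_char (?v + r) *
                      (\<psi> ((x + a / x) * ?u) * \<psi> (- ((x - a / x) * r))))"
      by (simp only: gauss_shift[symmetric] sum_distrib_left mult.left_commute)
    also have "\<dots> = (\<Sum>r\<in>UNIV. quad_char (?v + r) * \<psi> (x * (?u - r) + (a / x) * (?u + r)))"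
    proof (intro sum.cong refl)
      fix r
      have "(x + a / x) * ?u + - ((x - a / x) * r) = x * (?u - r) + (a / x) * (?u + r)"
        by (simp add: algebra_simps)
      thus "quad_char (?v + r) * (\<psi> ((x + a / x) * ?u) * \<psi> (- ((x - a / x) * r))) =
              quad_char (?v + r) * \<psi> (x * (?u - r) + (a / x) * (?u + r))"
        by (metis add)
    qed
    finally show ?thesis .
  qed
  hence "gauss * (\<Sum>x\<in>UNIV - {0}. quad_char (a / x - x) * \<psi> (x * (j + k)\<^sup>2 + (a / x) * (j - k)\<^sup>2)) =
           (\<Sum>x\<in>UNIV - {0}. \<Sum>r\<in>UNIV. quad_char (?v + r) * \<psi> (x * (?u - r) + (a / x) * (?u + r)))"
    by (simp only: sum_distrib_left)
  also have "\<dots> = (\<Sum>r\<in>UNIV. \<Sum>x\<in>UNIV - {0}. quad_char (?v + r) * \<psi> (x * (?u - r) + (a / x) * (?u + r)))"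
    by (rule sum.swap)
  also have "\<dots> = (\<Sum>r\<in>UNIV. quad_char (?v + r) * kloosterman (a * (?u\<^sup>2 - r\<^sup>2)))"
    by (simp only: sum_distrib_left[symmetric] kloosterman_product_form[OF u a])
  finally show ?thesis .
qed

end

section \<open>The quadratic extension and its octic character\<close>

locale quadratic_extension = odd_additive_character \<psi>
  for \<psi> :: "'k::{finite,field} \<Rightarrow> complex" +
  fixes p n :: nat and emb :: "'k \<Rightarrow> 'K::{finite,field}" and \<theta> :: "'K \<Rightarrow> complex"
  assumes prime: "prime p" and card_k: "CARD('k) = p ^ n"
    and card_mod_4: "CARD('k) mod 4 = 3" and card_K: "CARD('K) = CARD('k) ^ 2"
    and embedding: "field_embedding emb"
    and \<theta>_char: "mult_char \<theta>" and \<theta>_order: "mult_char_order \<theta> = 8"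
begin

lemma emb_1 [simp]: "emb 1 = 1"
  and emb_add: "emb (x + y) = emb x + emb y"
  and emb_mult: "emb (x * y) = emb x * emb y"
  using embedding by (auto simp: field_embedding_def)

lemma emb_0 [simp]: "emb 0 = 0"
  by (metis emb_add add_0_left add_cancel_right_right)

lemma emb_minus: "emb (- x) = - emb x"
  using emb_add[of x "- x"] by (simp add: eq_neg_iff_add_eq_0 add.commute)

lemma emb_diff: "emb (x - y) = emb x - emb y"
  using emb_add[of x "- y"] by (simp add: emb_minus)

lemma emb_power: "emb (x ^ m) = emb x ^ m"
  by (induction m) (auto simp: emb_mult)

lemma emb_eq_0_iff [simp]: "emb x = 0 \<longleftrightarrow> x = 0"
proof
  assume "emb x = 0"
  hence "emb (x * inverse x) = 0" by (simp add: emb_mult)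
  thus "x = 0" by (metis emb_1 right_inverse zero_neq_one)
qed simp

lemma inj_emb: "inj emb"
proof (rule injI)
  fix x y assume "emb x = emb y"
  hence "emb (x - y) = 0" by (simp add: emb_diff)
  thus "x = y" by simp
qed

lemma emb_eq_iff [simp]: "emb x = emb y \<longleftrightarrow> x = y"
  using inj_emb by (auto simp: inj_def)

lemma inv_emb [simp]: "inv emb (emb x) = x"
  by (simp add: inj_emb)

lemma emb_2: "emb 2 = 2"
  using emb_add[of 1 1] by simp

lemma two_K: "(2::'K) \<noteq> 0"
  using two emb_2 emb_eq_0_iff by metis

lemma minus_one_nonsquare: "(x::'k)\<^sup>2 \<noteq> -1"
proof
  assume x: "x\<^sup>2 = -1"
  obtain m where q: "CARD('k) = 4 * m + 3"
    using card_mod_4 by (metis mod_mult_div_eq add.commute)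
  have "x \<noteq> 0" using x by auto
  hence "1 = x ^ (CARD('k) - 1)" by (rule fermat_finite_field_unit[symmetric])
  also have "CARD('k) - 1 = 2 * (2 * m + 1)" using q by simp
  also have "x ^ \<dots> = (-1) ^ (2 * m + 1)" by (simp only: power_mult x)
  also have "\<dots> = -1" by simp
  finally show False using two by (metis add_eq_0_iff one_add_one)
qed

lemma quad_char_minus_one: "quad_char (-1 :: 'k) = -1"
  using minus_one_nonsquare by (auto simp: quad_char_def)

lemma quad_char_minus: "quad_char (- x :: 'k) = - quad_char x"
  using quad_char_mult[OF two, of "-1" x] by (simp add: quad_char_minus_one)

lemma quad_char_minus_commute: "quad_char (x - y :: 'k) = - quad_char (y - x)"
  using quad_char_minus[of "y - x"] by simp

lemma \<theta>_0 [simp]: "\<theta> 0 = 0" and \<theta>_1 [simp]: "\<theta> 1 = 1"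
  and \<theta>_mult: "\<theta> (x * y) = \<theta> x * \<theta> y"
  using \<theta>_char by (auto simp: mult_char_def)

lemma \<theta>_power: "\<theta> (x ^ m) = \<theta> x ^ m"
  by (induction m) (auto simp: \<theta>_mult)

lemma \<theta>_power_8: "x \<noteq> 0 \<Longrightarrow> \<theta> x ^ 8 = 1"
  and \<theta>_power_4_nontrivial: "\<exists>x. x \<noteq> 0 \<and> \<theta> x ^ 4 \<noteq> 1"
proof -
  let ?P = "\<lambda>m. m > 0 \<and> (\<forall>x. x \<noteq> 0 \<longrightarrow> \<theta> x ^ m = 1)"
  have "card {0, 1 :: 'K} \<le> CARD('K)" by (intro card_mono) auto
  hence "CARD('K) - 1 > 0" by simp
  moreover have "\<theta> x ^ (CARD('K) - 1) = 1" if "x \<noteq> 0" for x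
    by (simp only: \<theta>_power[symmetric] fermat_finite_field_unit[OF that] \<theta>_1)
  ultimately have "?P (CARD('K) - 1)" by blast
  hence "?P (LEAST m. ?P m)" by (rule LeastI)
  thus "x \<noteq> 0 \<Longrightarrow> \<theta> x ^ 8 = 1"
    using \<theta>_order by (simp add: mult_char_order_def)
  have "\<not> ?P 4"
    using not_less_Least[of 4 ?P] \<theta>_order by (simp add: mult_char_order_def)
  thus "\<exists>x. x \<noteq> 0 \<and> \<theta> x ^ 4 \<noteq> 1" by auto
qed

lemma \<theta>_nonzero: "x \<noteq> 0 \<Longrightarrow> \<theta> x \<noteq> 0"
  using \<theta>_power_8[of x] by auto

text \<open>
  The fourth power of a character of order eight is a nontrivial character with square one.
\<close>
lemma \<theta>_power_4: "\<theta> x ^ 4 = quad_char x"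
proof -
  obtain c where "c \<noteq> 0" "\<theta> c ^ 4 \<noteq> 1" using \<theta>_power_4_nontrivial by blast
  hence "(\<lambda>x. \<theta> x ^ 4) = quad_char"
    by (intro mult_char_eq_quad_char[OF two_K])
       (auto simp: mult_char_def \<theta>_mult power_mult_distrib \<theta>_power_8 simp flip: power_mult)
  thus ?thesis by metis
qed

lemma \<theta>_minus_one: "\<theta> (-1) ^ 2 = 1"
  by (simp flip: \<theta>_power)

definition imag :: 'K where
  "imag = (SOME i. i\<^sup>2 = -1)"

text \<open>
  \<open>-1\<close> is a square in the large field: its quadratic character is \<open>\<theta>(-1)\<^sup>4 = \<theta>((-1)\<^sup>4) = 1\<close>.
\<close>
lemma imag_square: "imag\<^sup>2 = -1"
proof -
  have "quad_char (-1 :: 'K) = (\<theta> (-1) ^ 2) ^ 2"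
    by (simp flip: \<theta>_power_4 power_mult)
  hence "quad_char (-1 :: 'K) = 1"
    by (simp add: \<theta>_minus_one)
  hence "\<exists>i::'K. i\<^sup>2 = -1" by (auto simp: quad_char_def split: if_splits)
  thus ?thesis unfolding imag_def by (rule someI_ex)
qed

lemma imag_mult: "imag * imag = -1" "imag * (imag * x) = - x"
  using imag_square by (simp_all add: power2_eq_square flip: mult.assoc)

definition frob :: "'K \<Rightarrow> 'K" where
  "frob z = z ^ CARD('k)"

definition tr :: "'K \<Rightarrow> 'k" where
  "tr z = inv emb (z + frob z)"

abbreviation nm :: "'K \<Rightarrow> 'k" where
  "nm z \<equiv> field_norm emb z"

lemma frob_add: "frob (x + y) = frob x + frob y"
proof -
  have "CHAR('K) = p"
    using CHAR_finite_field[OF prime, of "n * 2", where ?'k = 'K] card_K card_k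
    by (simp add: power_mult)
  thus ?thesis
    unfolding frob_def using prime card_k by (intro freshmans_dream') auto
qed

lemma frob_mult: "frob (x * y) = frob x * frob y"
  by (simp add: frob_def power_mult_distrib)

lemma frob_emb [simp]: "frob (emb x) = emb x"
  by (simp add: frob_def fermat_finite_field flip: emb_power)

lemma frob_imag: "frob imag = - imag"
proof -
  obtain m where q: "CARD('k) = 4 * m + 3"
    using card_mod_4 by (metis mod_mult_div_eq add.commute)
  have "frob imag = (imag\<^sup>2) ^ (2 * m + 1) * imag"
  proof -
    have "CARD('k) = 2 * (2 * m + 1) + 1" using q by simp
    thus ?thesis unfolding frob_def by (simp only: power_add power_mult power_one_right)
  qed
  also have "\<dots> = - imag" by (simp add: imag_square)
  finally show ?thesis .
qed

definition cart :: "'k \<times> 'k \<Rightarrow> 'K" where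
  "cart = (\<lambda>(x, y). emb x + imag * emb y)"

text \<open>
  A coincidence would make \<open>-1\<close> a square in the small field; surjectivity follows by counting.
\<close>
lemma bij_cart: "bij cart"
proof -
  have "inj cart"
  proof (rule injI, clarify)
    fix x y x' y'
    assume "cart (x, y) = cart (x', y')"
    hence "emb (x - x') = imag * emb (y' - y)"
      by (simp add: cart_def emb_diff algebra_simps)
    hence eq: "emb ((x - x')\<^sup>2) = emb (- ((y' - y)\<^sup>2))"
      by (simp add: emb_power emb_minus power_mult_distrib imag_square)
    hence eq: "(x - x')\<^sup>2 = - ((y' - y)\<^sup>2)" by simp
    have "y' - y = 0"
    proof (rule ccontr)
      assume "y' - y \<noteq> 0"
      hence "((x - x') / (y' - y))\<^sup>2 = -1" by (simp add: power_divide eq)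
      with minus_one_nonsquare show False by blast
    qed
    with eq show "x = x' \<and> y = y'" by simp
  qed
  moreover have "card (range cart) = CARD('K)"
    using \<open>inj cart\<close> by (simp add: card_image card_K power2_eq_square)
  hence "range cart = UNIV" by (intro card_subset_eq) auto
  ultimately show ?thesis by (simp add: bij_def)
qed

lemma cart_cases: obtains x y where "z = cart (x, y)"
  using bij_cart by (metis bij_pointE surj_pair)

lemma frob_cart: "frob (cart (x, y)) = cart (x, - y)"
  by (simp add: cart_def frob_add frob_mult frob_imag emb_minus)

lemma trace_cart [simp]: "tr (cart (x, y)) = 2 * x"
proof -
  have "cart (x, y) + frob (cart (x, y)) = emb (2 * x)"
    by (simp add: frob_cart) (simp add: cart_def emb_minus emb_mult emb_2)
  thus ?thesis by (simp add: tr_def)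
qed

lemma nm_cart [simp]: "nm (cart (x, y)) = x\<^sup>2 + y\<^sup>2"
proof -
  have "cart (x, y) * frob (cart (x, y)) = emb (x\<^sup>2 + y\<^sup>2)"
    by (simp add: frob_cart)
       (simp add: cart_def emb_minus emb_mult emb_add algebra_simps power2_eq_square imag_mult)
  thus ?thesis by (simp add: field_norm_def flip: frob_def)
qed

lemma emb_trace: "emb (tr z) = z + frob z"
  by (cases z rule: cart_cases) 
     (simp add: frob_cart, simp add: cart_def emb_minus emb_mult emb_2)

lemma emb_nm: "emb (nm z) = z * frob z"
  by (cases z rule: cart_cases) 
     (simp add: frob_cart,
      simp add: cart_def emb_minus emb_mult emb_add algebra_simps power2_eq_square imag_mult)

lemma frob_frob [simp]: "frob (frob z) = z"
  by (cases z rule: cart_cases) (simp add: frob_cart)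

lemma trace_frob [simp]: "tr (frob z) = tr z"
  by (cases z rule: cart_cases) (simp add: frob_cart)

lemma nm_frob [simp]: "nm (frob z) = nm z"
  by (cases z rule: cart_cases) (simp add: frob_cart)

lemma trace_add: "tr (x + y) = tr x + tr y"
  by (subst emb_eq_iff[symmetric]) (simp only: emb_trace emb_add frob_add ac_simps)

lemma nm_mult: "nm (x * y) = nm x * nm y"
  by (subst emb_eq_iff[symmetric]) (simp only: emb_nm emb_mult frob_mult ac_simps)

lemma nm_emb [simp]: "nm (emb x) = x\<^sup>2"
  by (subst emb_eq_iff[symmetric]) (simp only: emb_nm frob_emb power2_eq_square emb_mult)

lemma trace_emb_mult: "tr (emb c * z) = c * tr z"
  by (subst emb_eq_iff[symmetric]) (simp only: emb_trace emb_mult frob_mult frob_emb distrib_left)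

lemma nm_0 [simp]: "nm 0 = 0" and nm_1 [simp]: "nm 1 = 1" and nm_minus [simp]: "nm (- z) = nm z"
  and frob_1 [simp]: "frob 1 = 1" and frob_minus: "frob (- z) = - frob z"
proof -
  show "nm 0 = 0" "nm 1 = 1" using nm_emb[of 0] nm_emb[of 1] by simp_all
  show "frob 1 = 1" using frob_emb[of 1] by simp
  have "nm (-1) = 1" using nm_emb[of "-1"] by (simp add: emb_minus)
  thus "nm (- z) = nm z" using nm_mult[of "-1" z] by simp
  show "frob (- z) = - frob z"
    using frob_mult[of "emb (-1)" z] unfolding frob_emb by (simp add: emb_minus)
qed

lemma frob_eq_0_iff [simp]: "frob z = 0 \<longleftrightarrow> z = 0"
  by (simp add: frob_def)

lemma nm_eq_0_iff [simp]: "nm z = 0 \<longleftrightarrow> z = 0"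
  using emb_nm[of z] emb_eq_0_iff[of "nm z"] by simp

lemma nm_divide: "nm (x / y) = nm x / nm y"
proof (cases "y = 0")
  case False
  hence "nm (x / y) * nm y = nm x" by (simp flip: nm_mult)
  thus ?thesis using False by (simp add: eq_divide_eq)
qed simp

lemma nm_add: "nm (x + y) = nm x + nm y + tr (x * frob y)"
  by (subst emb_eq_iff[symmetric])
     (simp add: emb_nm emb_add emb_trace frob_add frob_mult algebra_simps)

lemma trace_square: "tr (z\<^sup>2) = (tr z)\<^sup>2 - 2 * nm z"
  by (subst emb_eq_iff[symmetric])
     (simp add: emb_diff emb_mult emb_2 emb_nm emb_trace emb_power power2_eq_square frob_mult algebra_simps)

lemma trace_minus: "tr (- z) = - tr z"
  by (subst emb_eq_iff[symmetric]) (simp add: emb_trace emb_minus frob_minus)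

text \<open>
  Both sides are characters with values \<open>\<plusminus>1\<close>, so only nontriviality of the right-hand side is at
  stake. If every nonzero norm \<open>x\<^sup>2 + y\<^sup>2\<close> were a square, then all sums of squares would be
  squares, among them \<open>p - 1 = -1\<close>.
\<close>
lemma quad_char_K: "quad_char z = quad_char (nm z)"
proof -
  have "\<exists>c. c \<noteq> 0 \<and> quad_char (nm c) \<noteq> 1"
  proof (rule ccontr)
    assume *: "\<nexists>c. c \<noteq> 0 \<and> quad_char (nm c) \<noteq> 1"
    have "\<exists>r. r\<^sup>2 = (of_nat m :: 'k)" for m
    proof (induction m)
      case 0
      show ?case by (rule exI[of _ 0]) simp
    next
      case (Suc m)
      then obtain r where r: "r\<^sup>2 = (of_nat m :: 'k)" ..
      have nm: "nm (cart (r, 1)) = of_nat (Suc m)" by (simp add: r)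
      show ?case
      proof (cases "cart (r, 1) = 0")
        case True
        thus ?thesis using nm by (intro exI[of _ 0]) simp
      next
        case False
        with * have "quad_char (nm (cart (r, 1))) = 1" by blast
        thus ?thesis unfolding nm by (auto simp: quad_char_def split: if_splits)
      qed
    qed
    then obtain r where "r\<^sup>2 = (of_nat (p - 1) :: 'k)" by blast
    moreover have "of_nat (p - 1) + 1 = (of_nat p :: 'k)"
      using prime_gt_0_nat[OF prime] by (metis of_nat_Suc Suc_pred' add.commute)
    moreover have "(of_nat p :: 'k) = 0"
      using CHAR_finite_field[OF prime card_k] of_nat_CHAR by metis
    ultimately have "r\<^sup>2 = -1" by (simp add: eq_neg_iff_add_eq_0)
    with minus_one_nonsquare show False by blast
  qed
  then obtain c where "c \<noteq> 0" "quad_char (nm c) \<noteq> 1" by blast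
  hence "(\<lambda>z. quad_char (nm z)) = quad_char"
    by (intro mult_char_eq_quad_char[OF two_K])
       (auto simp: mult_char_def nm_mult quad_char_mult[OF two] quad_char_power2)
  thus ?thesis by metis
qed

section \<open>Sums over the elements of a given norm\<close>

text \<open>
  An element of trace \<open>s\<close> and norm \<open>b\<close> is \<open>s/2 + i y\<close> with \<open>y\<^sup>2 = b - s\<^sup>2/4\<close>, and \<open>-1\<close> is a
  non-square, which accounts for the sign.
\<close>
lemma sum_norm_fibre_by_trace:
  "(\<Sum>z | nm z = b. f (tr z)) = (\<Sum>s\<in>UNIV. f s * (1 - quad_char (s\<^sup>2 - 4 * b)))"
  for f :: "'k \<Rightarrow> complex"
proof -
  have "of_nat (card {z \<in> {z. nm z = b}. tr z = s}) = 1 - quad_char (s\<^sup>2 - 4 * b)" for s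
  proof -
    have "bij_betw (\<lambda>y. cart (s / 2, y)) {y. y\<^sup>2 = b - (s / 2)\<^sup>2} {z \<in> {z. nm z = b}. tr z = s}"
      unfolding bij_betw_def
    proof (intro conjI)
      show "inj_on (\<lambda>y. cart (s / 2, y)) {y. y\<^sup>2 = b - (s / 2)\<^sup>2}"
        using bij_cart by (auto simp: inj_on_def bij_def)
      show "(\<lambda>y. cart (s / 2, y)) ` {y. y\<^sup>2 = b - (s / 2)\<^sup>2} = {z \<in> {z. nm z = b}. tr z = s}"
      proof (intro equalityI subsetI)
        fix z assume z: "z \<in> {z \<in> {z. nm z = b}. tr z = s}"
        obtain x y where xy: "z = cart (x, y)" by (rule cart_cases)
        have x: "x = s / 2" using z two unfolding xy by auto
        have "y \<in> {y. y\<^sup>2 = b - (s / 2)\<^sup>2}" using z unfolding xy x by auto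
        thus "z \<in> (\<lambda>y. cart (s / 2, y)) ` {y. y\<^sup>2 = b - (s / 2)\<^sup>2}"
          unfolding xy x by (rule imageI)
      qed (use two in auto)
    qed
    hence "card {z \<in> {z. nm z = b}. tr z = s} = card {y. y\<^sup>2 = b - (s / 2)\<^sup>2}"
      by (rule bij_betw_same_card[symmetric])
    moreover have "quad_char (s\<^sup>2 - 4 * b) = - quad_char (b - (s / 2)\<^sup>2)"
    proof -
      obtain h where h: "h = s / 2" by blast
      hence "s = 2 * h" using two by (simp add: mult.commute)
      hence "s\<^sup>2 - 4 * b = - ((2\<^sup>2) * (b - h\<^sup>2))" by algebra
      hence "s\<^sup>2 - 4 * b = - ((2\<^sup>2) * (b - (s / 2)\<^sup>2))" unfolding h .
      moreover have "quad_char ((2::'k)\<^sup>2) = 1" by (rule quad_char_square[OF two])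
      ultimately show ?thesis
        by (simp only: quad_char_minus quad_char_mult[OF two] mult_1)
    qed
    ultimately show ?thesis by (simp add: card_quadratic_roots[OF two])
  qed
  thus ?thesis
    using sum_fun_comp[of "{z. nm z = b}" UNIV tr f] by (simp add: mult.commute)
qed

text \<open>
  Adding the two counts cancels the quadratic characters and leaves \<open>2 \<Sum>\<^sub>s \<psi>(s) = 0\<close>.
\<close>
lemma sum_trace_kloosterman:
  assumes "b \<noteq> 0"
  shows "(\<Sum>z | nm z = b. \<psi> (tr z)) = - kloosterman b"
proof -
  have "(\<Sum>z | nm z = b. \<psi> (tr z)) + kloosterman b = (\<Sum>s\<in>UNIV. 2 * \<psi> s)"
    unfolding kloosterman_def sum_norm_fibre_by_trace sum_hyperbola_by_trace[OF two assms]
    by (simp add: algebra_simps flip: sum.distrib)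
  also have "\<dots> = 0" by (simp add: sum_eq_0 flip: sum_distrib_left)
  finally show ?thesis by (simp add: eq_neg_iff_add_eq_0)
qed

text \<open>
  The same addition of counts, with \<open>\<psi>\<close> replaced by the constant \<open>1\<close>.
\<close>
lemma card_norm_fibre:
  assumes "b \<noteq> 0"
  shows "(of_nat (card {z. nm z = b}) :: complex) = of_nat CARD('k) + 1"
proof -
  have "(\<Sum>z | nm z = b. 1) + (\<Sum>x\<in>UNIV - {0::'k}. 1) = (\<Sum>s\<in>(UNIV::'k set). 2 :: complex)"
    unfolding sum_norm_fibre_by_trace[where f = "\<lambda>_. 1"] sum_hyperbola_by_trace[OF two assms, where f = "\<lambda>_. 1"]
    by (simp add: algebra_simps flip: sum.distrib)
  thus ?thesis
    by (simp add: card_Diff_singleton of_nat_diff Suc_leI finite_UNIV_card_ge_0 algebra_simps)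
qed

section \<open>Sums over the norm-one group\<close>

text \<open>
  With \<open>w = 1 + u\<close> one has \<open>u w\<^sup>q = w\<close>, hence \<open>\<theta>(u)\<^sup>2 = \<theta>(w)\<close> to the power \<open>2 - 2q \<equiv> 4 (mod 8)\<close>,
  which is the quadratic character of the norm \<open>N w = 2 + tr u\<close>.
\<close>
lemma norm_one_square_value:
  assumes u: "nm u = 1" "u \<noteq> -1"
  shows "\<theta> u ^ 2 = quad_char (2 + tr u)"
proof -
  define w where "w = 1 + u"
  have w: "w \<noteq> 0" using u(2) by (auto simp: w_def add_eq_0_iff)
  obtain m where q: "CARD('k) = 4 * m + 3"
    using card_mod_4 by (metis mod_mult_div_eq add.commute)
  have "u * frob w = w"
    using emb_nm[of u] u(1) by (simp add: w_def frob_add distrib_left)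
  hence "\<theta> w ^ 2 = \<theta> u ^ 2 * \<theta> w ^ (2 * CARD('k))"
    by (metis \<theta>_mult \<theta>_power frob_def power_mult_distrib power_mult mult.commute)
  also have "2 * CARD('k) = 8 * m + 6" using q by simp
  also have "\<theta> w ^ (8 * m + 6) = \<theta> w ^ 6"
    by (simp only: power_add power_mult \<theta>_power_8[OF w] power_one mult_1)
  finally have "\<theta> w ^ 2 * \<theta> w ^ 2 = \<theta> u ^ 2 * (\<theta> w ^ 6 * \<theta> w ^ 2)" by simp
  hence "\<theta> u ^ 2 = \<theta> w ^ 4"
    using \<theta>_power_8[OF w] by (simp flip: power_add)
  also have "\<dots> = quad_char (nm w)" by (simp add: \<theta>_power_4 quad_char_K)
  also have "nm w = 2 + tr u"
    using u(1) by (simp add: w_def nm_add)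
  finally show ?thesis .
qed

text \<open>
  By the previous lemma \<open>N(1 + t) = e\<^sup>2\<close> for some \<open>e\<close>, and \<open>(1 + t)/e\<close> is a square root of \<open>t\<close> of
  norm one. The remaining element \<open>t = -1\<close> is \<open>i\<^sup>2\<close>.
\<close>
lemma norm_one_square_root:
  assumes t: "nm t = 1" and sq: "\<theta> t ^ 2 = 1"
  shows "\<exists>u. nm u = 1 \<and> u\<^sup>2 = t"
proof (cases "t = -1")
  case True
  have "nm imag = 1" using nm_cart[of 0 1] by (simp add: cart_def)
  with True imag_square show ?thesis by blast
next
  case False
  hence "quad_char (2 + tr t) = 1" using norm_one_square_value[OF t] sq by simp
  hence "2 + tr t \<noteq> 0 \<and> (\<exists>e. e\<^sup>2 = 2 + tr t)"
    by (auto simp: quad_char_def split: if_splits)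
  then obtain e where e: "e\<^sup>2 = 2 + tr t" "e \<noteq> 0" by (metis zero_power2)
  define u where "u = emb (inverse e) * (1 + t)"
  have nm: "nm (1 + t) = e\<^sup>2" using t e by (simp add: nm_add)
  have "nm u = 1" using e(2) by (simp add: u_def nm_mult nm power_inverse)
  moreover have "u\<^sup>2 = t"
  proof -
    have t1: "t * frob t = 1" using emb_nm[of t] t by simp
    have "emb (e\<^sup>2) = (1 + t) * (1 + frob t)"
      by (simp only: nm[symmetric] emb_nm frob_add frob_1)
    hence "t * emb (e\<^sup>2) = (1 + t)\<^sup>2"
      using t1 by algebra
    moreover have "emb (e\<^sup>2) * emb (inverse (e\<^sup>2)) = 1" using e(2) by (simp flip: emb_mult)
    moreover have "u\<^sup>2 = emb (inverse (e\<^sup>2)) * (1 + t)\<^sup>2"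
      by (simp add: u_def power_mult_distrib power_inverse flip: emb_power)
    ultimately show ?thesis by algebra
  qed
  ultimately show ?thesis by blast
qed

text \<open>
  Averaging over \<open>t\<close> and its inverse, which have the same trace, replaces \<open>\<theta>(t)\<close> by
  \<open>(\<theta>(t) + \<theta>(t)\<^sup>-\<^sup>1)/2\<close>. On squares this is \<open>\<theta>(t) = \<plusminus>1\<close>; on non-squares \<open>\<theta>(t) = \<plusminus>i\<close> and it vanishes. In
  both cases the sum of the two values is \<open>\<theta>(t)\<close> times the number of square roots of \<open>t\<close>.
\<close>
lemma sum_norm_one_symmetrise:
  fixes F :: "'k \<Rightarrow> complex"
  shows "2 * (\<Sum>t | nm t = 1. \<theta> t * F (tr t)) =
           (\<Sum>u | nm u = 1. \<theta> u ^ 2 * F ((tr u)\<^sup>2 - 2))"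
proof -
  have "(\<Sum>t | nm t = 1. \<theta> t * F (tr t)) = (\<Sum>t | nm t = 1. \<theta> (frob t) * F (tr t))"
    by (rule sum.reindex_bij_witness[of _ frob frob]) auto
  hence "2 * (\<Sum>t | nm t = 1. \<theta> t * F (tr t)) =
           (\<Sum>t | nm t = 1. (\<theta> t + \<theta> (frob t)) * F (tr t))"
    by (simp add: distrib_right sum.distrib)
  also have "\<dots> = (\<Sum>t | nm t = 1. of_nat (card {u \<in> {u. nm u = 1}. u\<^sup>2 = t}) * (\<theta> t * F (tr t)))"
  proof (intro sum.cong refl)
    fix t assume "t \<in> {t. nm t = 1}"
    hence t: "nm t = 1" by simp
    have "t * frob t = 1" using emb_nm[of t] t by simp
    hence inv: "\<theta> t * \<theta> (frob t) = 1" by (metis \<theta>_mult \<theta>_1)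
    have "\<theta> t ^ 4 = 1" using t by (simp add: \<theta>_power_4 quad_char_K)
    hence "(\<theta> t ^ 2) ^ 2 = 1" by (simp flip: power_mult)
    hence cases: "\<theta> t ^ 2 = 1 \<or> \<theta> t ^ 2 = -1" by (simp only: power2_eq_1_iff)
    have "\<theta> t + \<theta> (frob t) = of_nat (card {u \<in> {u. nm u = 1}. u\<^sup>2 = t}) * \<theta> t"
    proof (cases "\<exists>u. nm u = 1 \<and> u\<^sup>2 = t")
      case True
      then obtain u where u: "nm u = 1" "u\<^sup>2 = t" by blast
      have set: "{u \<in> {u. nm u = 1}. u\<^sup>2 = t} = {u, - u}"
        using u by (auto simp: power2_eq_iff)
      have "u \<noteq> 0" using u by auto
      hence "u \<noteq> - u"
        using two_K by (metis add_eq_0_iff mult_2 mult_eq_0_iff)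
      hence card: "card {u \<in> {u. nm u = 1}. u\<^sup>2 = t} = 2" unfolding set by simp
      have "\<theta> t ^ 2 = \<theta> u ^ 4" by (simp add: \<theta>_power flip: u(2) power_mult)
      also have "\<dots> = 1" using u by (simp add: \<theta>_power_4 quad_char_K)
      finally have "\<theta> t * \<theta> t = 1" by (simp add: power2_eq_square)
      hence "\<theta> (frob t) = \<theta> t" using inv by algebra
      thus ?thesis unfolding card by simp
    next
      case False
      hence "{u \<in> {u. nm u = 1}. u\<^sup>2 = t} = {}" by auto
      moreover have "\<theta> t * \<theta> t = -1"
        using False cases norm_one_square_root[OF t] by (auto simp: power2_eq_square)
      hence "\<theta> (frob t) = - \<theta> t" using inv by algebra
      ultimately show ?thesis by simp
    qed
    thus "(\<theta> t + \<theta> (frob t)) * F (tr t) =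
            of_nat (card {u \<in> {u. nm u = 1}. u\<^sup>2 = t}) * (\<theta> t * F (tr t))"
      by simp
  qed
  also have "\<dots> = (\<Sum>u | nm u = 1. \<theta> (u\<^sup>2) * F (tr (u\<^sup>2)))"
    by (rule sum_fun_comp[symmetric]) (auto simp: power2_eq_square nm_mult)
  also have "\<dots> = (\<Sum>u | nm u = 1. \<theta> u ^ 2 * F ((tr u)\<^sup>2 - 2))"
    by (intro sum.cong refl) (simp add: \<theta>_power trace_square)
  finally show ?thesis .
qed

text \<open>
  Counting the elements of trace \<open>s\<close> inserts the factor \<open>1 - \<phi>(s\<^sup>2 - 4)\<close>, whose product with \<open>\<phi>(2 + s)\<close>
  is \<open>\<phi>(2 + s) + \<phi>(2 - s)\<close>; the value \<open>s = -2\<close>, where \<open>\<theta>(-1)\<^sup>2 = 1\<close> but \<open>\<phi>(2 + s) = 0\<close>, fits the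
  same formula.
\<close>
lemma sum_norm_one_even:
  fixes H :: "'k \<Rightarrow> complex"
  assumes even: "\<And>s. H (- s) = H s"
  shows "(\<Sum>u | nm u = 1. \<theta> u ^ 2 * H (tr u)) = 2 * (\<Sum>s\<in>UNIV. quad_char (2 + s) * H s)"
proof -
  \<comment> \<open>the value \<open>1\<close> at \<open>-2\<close> is \<open>\<theta>(-1)\<^sup>2\<close>, the only element of trace \<open>-2\<close> being \<open>-1\<close>\<close>
  define f where "f s = (if s = -2 then 1 else quad_char (2 + s)) * H s" for s
  have neg2: "(2::'k) \<noteq> -2"
    using two by (metis add_eq_0_iff mult_2 mult_eq_0_iff)
  have minus_1: "u = -1" if "nm u = 1" "tr u = -2" for u
  proof -
    have "nm (1 + u) = 0" using that by (simp add: nm_add)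
    thus ?thesis by (simp add: add_eq_0_iff)
  qed
  have tr1: "tr (-1) = -2"
    using trace_cart[of "-1" 0] by (simp add: cart_def emb_minus)
  have "(\<Sum>u | nm u = 1. \<theta> u ^ 2 * H (tr u)) = (\<Sum>u | nm u = 1. f (tr u))"
  proof (intro sum.cong refl)
    fix u assume "u \<in> {u. nm u = 1}"
    hence u: "nm u = 1" by simp
    show "\<theta> u ^ 2 * H (tr u) = f (tr u)"
    proof (cases "u = -1")
      case True
      show ?thesis unfolding True tr1 f_def by (simp add: \<theta>_minus_one)
    next
      case False
      hence "tr u \<noteq> -2" using minus_1[OF u] by blast
      thus ?thesis by (simp add: f_def norm_one_square_value[OF u False])
    qed
  qed
  also have "\<dots> = (\<Sum>s\<in>UNIV. f s * (1 - quad_char (s\<^sup>2 - 4)))"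
    by (simp add: sum_norm_fibre_by_trace)
  also have "\<dots> = (\<Sum>s\<in>UNIV. quad_char (2 + s) * H s + quad_char (2 - s) * H s)"
  proof (intro sum.cong refl)
    fix s :: 'k
    have eq: "s\<^sup>2 - 4 = - ((2 + s) * (2 - s))" by (simp add: power2_eq_square algebra_simps)
    have qc: "quad_char (s\<^sup>2 - 4) = - (quad_char (2 + s) * quad_char (2 - s))"
      unfolding eq quad_char_minus quad_char_mult[OF two] ..
    have four: "quad_char (4 :: 'k) = 1"
      using quad_char_square[OF two] by simp
    show "f s * (1 - quad_char (s\<^sup>2 - 4)) = quad_char (2 + s) * H s + quad_char (2 - s) * H s"
    proof (cases "s = -2")
      case True
      thus ?thesis by (simp add: f_def four)
    next
      case False
      hence "2 + s \<noteq> 0" by (metis add_eq_0_iff add.commute)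
      hence "quad_char (2 + s) * quad_char (2 + s) = 1"
        using quad_char_power2[of "2 + s"] by (simp add: power2_eq_square)
      thus ?thesis using False unfolding f_def qc by (simp add: algebra_simps)
    qed
  qed
  also have "\<dots> = (\<Sum>s\<in>UNIV. quad_char (2 + s) * H s) + (\<Sum>s\<in>UNIV. quad_char (2 - s) * H s)"
    by (rule sum.distrib)
  also have "(\<Sum>s\<in>UNIV. quad_char (2 - s) * H s) = (\<Sum>s\<in>UNIV. quad_char (2 + s) * H s)"
    by (rule sum.reindex_bij_witness[of _ uminus uminus]) (auto simp: even)
  finally show ?thesis by simp
qed

lemma sum_norm_one:
  "(\<Sum>t | nm t = 1. \<theta> t * F (tr t)) = (\<Sum>s\<in>UNIV. quad_char (2 + s) * F (s\<^sup>2 - 2))"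
  for F :: "'k \<Rightarrow> complex"
  using sum_norm_one_symmetrise[of F] sum_norm_one_even[of "\<lambda>s. F (s\<^sup>2 - 2)"] by simp

section \<open>The product of two norm sums\<close>

text \<open>
  For \<open>c = 0\<close> the sum is \<open>q + 1\<close>, and the \<open>1\<close> is \<open>-K(0)\<close>.
\<close>
lemma sum_norm_scaled:
  assumes a: "a \<noteq> 0"
  shows "(\<Sum>z | nm z = a. \<psi> (tr (c * z))) =
           - kloosterman (a * nm c) + (if c = 0 then of_nat CARD('k) else 0)"
proof (cases "c = 0")
  case True
  have "tr 0 = 0" using trace_cart[of 0 0] by (simp add: cart_def)
  with True show ?thesis by (simp add: card_norm_fibre[OF a] kloosterman_0)
next
  case False
  have "(\<Sum>z | nm z = a. \<psi> (tr (c * z))) = (\<Sum>z | nm z = a * nm c. \<psi> (tr z))"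
    by (rule sum.reindex_bij_witness[of _ "\<lambda>z. z / c" "\<lambda>z. c * z"])
       (use False in \<open>auto simp: nm_mult nm_divide\<close>)
  also have "\<dots> = - kloosterman (a * nm c)"
    using a False by (intro sum_trace_kloosterman) simp
  finally show ?thesis using False by simp
qed

text \<open>The sum in the definition of \<open>V\<close>.\<close>
definition norm_sum :: "'k \<Rightarrow> 'k \<Rightarrow> complex" where
  "norm_sum a j = (\<Sum>z | nm z = a. \<theta> z * \<psi> (tr (emb (j\<^sup>2) * z)))"

text \<open>
  For fixed \<open>z\<close> the elements \<open>w\<close> of norm \<open>a\<close> are parametrised as \<open>z\<^sup>q t\<close>. Then \<open>z w = a t\<close>,
  and \<open>tr(k\<^sup>2 z\<^sup>q t) = tr(k\<^sup>2 z t\<^sup>q)\<close>, so the additive characters combine into one.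
\<close>
lemma norm_sum_product:
  assumes a: "a \<noteq> 0"
  shows "norm_sum a j * norm_sum a k = \<theta> (emb a) * (\<Sum>t | nm t = 1. \<theta> t *
           (\<Sum>z | nm z = a. \<psi> (tr ((emb (j\<^sup>2) + emb (k\<^sup>2) * frob t) * z))))"
proof -
  let ?g = "\<lambda>z w. \<theta> z * \<psi> (tr (emb (j\<^sup>2) * z)) * (\<theta> w * \<psi> (tr (emb (k\<^sup>2) * w)))"
  have "norm_sum a j * norm_sum a k = (\<Sum>z | nm z = a. \<Sum>w | nm w = a. ?g z w)"
    unfolding norm_sum_def by (rule sum_product)
  also have "\<dots> = (\<Sum>z | nm z = a. \<Sum>t | nm t = 1. \<theta> (emb a) * (\<theta> t *
                    \<psi> (tr ((emb (j\<^sup>2) + emb (k\<^sup>2) * frob t) * z))))"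
  proof (rule sum.cong[OF refl])
    fix z assume "z \<in> {z. nm z = a}"
    hence z: "nm z = a" by simp
    hence nz: "frob z \<noteq> 0" using a by auto
    have "(\<Sum>w | nm w = a. ?g z w) = (\<Sum>t | nm t = 1. ?g z (frob z * t))"
      by (rule sum.reindex_bij_witness[of _ "\<lambda>t. frob z * t" "\<lambda>w. w / frob z"])
         (use nz a z in \<open>auto simp: nm_mult nm_divide\<close>)
    also have "\<dots> = (\<Sum>t | nm t = 1. \<theta> (emb a) * (\<theta> t *
                    \<psi> (tr ((emb (j\<^sup>2) + emb (k\<^sup>2) * frob t) * z))))"
    proof (intro sum.cong refl)
      fix t
      have \<theta>_eq: "\<theta> z * \<theta> (frob z * t) = \<theta> (emb a) * \<theta> t"
        by (simp add: emb_nm \<theta>_mult flip: z)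
      have tr_eq: "tr (emb (k\<^sup>2) * (frob z * t)) = tr (emb (k\<^sup>2) * frob t * z)"
        using trace_frob[of "emb (k\<^sup>2) * (frob z * t)"] by (simp add: frob_mult mult_ac del: trace_frob)
      have "?g z (frob z * t) = (\<theta> z * \<theta> (frob z * t)) *
              (\<psi> (tr (emb (j\<^sup>2) * z)) * \<psi> (tr (emb (k\<^sup>2) * (frob z * t))))"
        by (simp only: mult_ac)
      also have "\<dots> = \<theta> (emb a) * (\<theta> t * \<psi> (tr ((emb (j\<^sup>2) + emb (k\<^sup>2) * frob t) * z)))"
        unfolding \<theta>_eq tr_eq by (simp only: distrib_right trace_add add mult.assoc)
      finally show "?g z (frob z * t) = \<theta> (emb a) * (\<theta> t *
                    \<psi> (tr ((emb (j\<^sup>2) + emb (k\<^sup>2) * frob t) * z)))" .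
    qed
    finally show "(\<Sum>w | nm w = a. ?g z w) = (\<Sum>t | nm t = 1. \<theta> (emb a) * (\<theta> t *
                    \<psi> (tr ((emb (j\<^sup>2) + emb (k\<^sup>2) * frob t) * z))))" .
  qed
  also have "\<dots> = (\<Sum>t | nm t = 1. \<Sum>z | nm z = a. \<theta> (emb a) * (\<theta> t *
                    \<psi> (tr ((emb (j\<^sup>2) + emb (k\<^sup>2) * frob t) * z))))"
    by (rule sum.swap)
  finally show ?thesis by (simp only: sum_distrib_left)
qed

lemma twist_vanishes_iff:
  assumes t: "nm t = 1" and k: "k \<noteq> 0"
  shows "emb (j\<^sup>2) + emb (k\<^sup>2) * frob t = 0 \<longleftrightarrow> t = -1 \<and> j\<^sup>2 = k\<^sup>2"
proof
  assume z: "emb (j\<^sup>2) + emb (k\<^sup>2) * frob t = 0"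
  hence eq: "emb (k\<^sup>2) * frob t = - emb (j\<^sup>2)" by (simp add: eq_neg_iff_add_eq_0 add.commute)
  hence "nm (emb (k\<^sup>2) * frob t) = nm (- emb (j\<^sup>2))" by simp
  hence "(k\<^sup>2)\<^sup>2 = (j\<^sup>2)\<^sup>2" by (simp only: nm_mult nm_emb nm_frob nm_minus t mult_1_right)
  hence cases: "k\<^sup>2 = j\<^sup>2 \<or> k\<^sup>2 = - (j\<^sup>2)" by (simp only: power2_eq_iff)
  have "k\<^sup>2 \<noteq> - (j\<^sup>2)"
  proof
    assume "k\<^sup>2 = - (j\<^sup>2)"
    moreover from this have "j \<noteq> 0" using k by auto
    ultimately have "(k / j)\<^sup>2 = -1" by (simp add: power_divide)
    with minus_one_nonsquare show False by blast
  qed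
  with cases have jk: "k\<^sup>2 = j\<^sup>2" by blast
  have "emb (k\<^sup>2) * (frob t + 1) = 0" using eq by (simp add: jk distrib_left)
  hence "frob t = -1" using k by (simp add: eq_neg_iff_add_eq_0)
  hence "t = frob (-1)" by (metis frob_frob)
  hence "t = -1" by (simp add: frob_minus)
  with jk show "t = -1 \<and> j\<^sup>2 = k\<^sup>2" by simp
qed (simp add: frob_minus)

text \<open>
  Here \<open>N(c) = j\<^sup>4 + k\<^sup>4 + j\<^sup>2 k\<^sup>2 tr t\<close>. The substitution \<open>t \<mapsto> -t\<close> produces the factor \<open>\<theta>(-1)\<close>
  and a minus sign; then \<open>tr t\<close> becomes \<open>s\<^sup>2 - 2\<close>, which completes the square:
  \<open>j\<^sup>4 + k\<^sup>4 - j\<^sup>2 k\<^sup>2 (s\<^sup>2 - 2) = (j\<^sup>2 + k\<^sup>2)\<^sup>2 - (j k s)\<^sup>2\<close>.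
\<close>
lemma norm_sum_product_kloosterman:
  assumes a: "a \<noteq> 0" and j: "j \<noteq> 0" and k: "k \<noteq> 0"
  shows "norm_sum a j * norm_sum a k = \<theta> (emb (- a)) *
           ((if j\<^sup>2 = k\<^sup>2 then of_nat CARD('k) else 0) - quad_char (j * k) *
             (\<Sum>r\<in>UNIV. quad_char (2 * j * k + r) * kloosterman (a * ((j\<^sup>2 + k\<^sup>2)\<^sup>2 - r\<^sup>2))))"
proof -
  define c where "c t = emb (j\<^sup>2) + emb (k\<^sup>2) * frob t" for t
  define F where "F r = kloosterman (a * (j ^ 4 + k ^ 4 - (j * k)\<^sup>2 * r))" for r
  let ?d = "if j\<^sup>2 = k\<^sup>2 then of_nat CARD('k) else 0 :: complex"
  have inner: "(\<Sum>z | nm z = a. \<psi> (tr (c t * z))) = - F (tr (- t)) + (if t = -1 then ?d else 0)"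
    if t: "nm t = 1" for t
  proof -
    have "tr (emb (j\<^sup>2) * frob (emb (k\<^sup>2) * frob t)) = tr (emb ((j * k)\<^sup>2) * t)"
      by (simp add: frob_mult emb_mult power_mult_distrib mult.assoc)
    also have "\<dots> = (j * k)\<^sup>2 * tr t" by (rule trace_emb_mult)
    finally have "nm (c t) = (j\<^sup>2)\<^sup>2 + (k\<^sup>2)\<^sup>2 + (j * k)\<^sup>2 * tr t"
      by (simp only: c_def nm_add nm_mult nm_emb nm_frob t mult_1_right)
    hence "nm (c t) = j ^ 4 + k ^ 4 - (j * k)\<^sup>2 * tr (- t)"
      by (simp add: trace_minus flip: power_mult)
    thus ?thesis
      using twist_vanishes_iff[OF t k, of j] unfolding sum_norm_scaled[OF a] F_def
      by (simp add: c_def)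
  qed
  have "norm_sum a j * norm_sum a k =
          \<theta> (emb a) * (\<Sum>t | nm t = 1. \<theta> t * (- F (tr (- t)) + (if t = -1 then ?d else 0)))"
    unfolding norm_sum_product[OF a] c_def[symmetric] by (simp add: inner)
  also have "(\<Sum>t | nm t = 1. \<theta> t * (- F (tr (- t)) + (if t = -1 then ?d else 0))) =
               (\<Sum>t | nm t = 1. if t = -1 then \<theta> t * ?d else 0) - (\<Sum>t | nm t = 1. \<theta> t * F (tr (- t)))"
    unfolding sum_subtractf[symmetric] by (intro sum.cong refl) (auto simp: algebra_simps)
  also have "(\<Sum>t | nm t = 1. if t = -1 then \<theta> t * ?d else 0) = \<theta> (-1) * ?d"
    by (subst sum.delta) auto
  also have "(\<Sum>t | nm t = 1. \<theta> t * F (tr (- t))) = (\<Sum>t | nm t = 1. \<theta> (-1) * (\<theta> t * F (tr t)))"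
  proof (rule sum.reindex_bij_witness[of _ uminus uminus])
    fix t
    show "\<theta> (-1) * (\<theta> (- t) * F (tr (- t))) = \<theta> t * F (tr (- t))"
      using \<theta>_mult[of "-1" "- t"] by simp
  qed auto
  also have "\<dots> = \<theta> (-1) * (\<Sum>t | nm t = 1. \<theta> t * F (tr t))"
    by (rule sum_distrib_left[symmetric])
  also have "(\<Sum>t | nm t = 1. \<theta> t * F (tr t)) = (\<Sum>s\<in>UNIV. quad_char (2 + s) * F (s\<^sup>2 - 2))"
    by (rule sum_norm_one)
  also have "\<dots> = quad_char (j * k) *
      (\<Sum>r\<in>UNIV. quad_char (2 * j * k + r) * kloosterman (a * ((j\<^sup>2 + k\<^sup>2)\<^sup>2 - r\<^sup>2)))"
    unfolding sum_distrib_left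
  proof (rule sum.reindex_bij_witness[of _ "\<lambda>r. r / (j * k)" "\<lambda>s. j * k * s"])
    fix s
    have "2 * j * k + j * k * s = (j * k) * (2 + s)" by (simp add: algebra_simps)
    hence split: "quad_char (2 * j * k + j * k * s) = quad_char (j * k) * quad_char (2 + s)"
      by (simp only: quad_char_mult[OF two])
    have sq: "quad_char (j * k) * quad_char (j * k) = 1"
      using quad_char_power2[of "j * k"] j k by (simp add: power2_eq_square)
    have arg: "j ^ 4 + k ^ 4 - (j * k)\<^sup>2 * (s\<^sup>2 - 2) = (j\<^sup>2 + k\<^sup>2)\<^sup>2 - (j * k * s)\<^sup>2"
      by algebra
    show "quad_char (j * k) * (quad_char (2 * j * k + j * k * s) *
            kloosterman (a * ((j\<^sup>2 + k\<^sup>2)\<^sup>2 - (j * k * s)\<^sup>2))) = quad_char (2 + s) * F (s\<^sup>2 - 2)"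
      unfolding F_def arg split mult.assoc[symmetric] sq by simp
  qed (use j k in auto)
  also have "\<theta> (emb a) * (\<theta> (-1) * ?d - \<theta> (-1) * (quad_char (j * k) *
      (\<Sum>r\<in>UNIV. quad_char (2 * j * k + r) * kloosterman (a * ((j\<^sup>2 + k\<^sup>2)\<^sup>2 - r\<^sup>2))))) =
      \<theta> (emb a) * \<theta> (-1) * (?d - quad_char (j * k) *
      (\<Sum>r\<in>UNIV. quad_char (2 * j * k + r) * kloosterman (a * ((j\<^sup>2 + k\<^sup>2)\<^sup>2 - r\<^sup>2))))"
    by (simp only: right_diff_distrib mult.assoc)
  also have "\<theta> (emb a) * \<theta> (-1) = \<theta> (emb (- a))"
    using \<theta>_mult[of "emb a" "-1"] by (simp add: emb_minus)
  finally show ?thesis .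
qed

section \<open>The identity\<close>

lemma sum_of_squares_nonzero:
  assumes "k \<noteq> (0::'k)"
  shows "j\<^sup>2 + k\<^sup>2 \<noteq> 0"
proof
  assume "j\<^sup>2 + k\<^sup>2 = 0"
  hence "j\<^sup>2 = - (k\<^sup>2)" by (simp add: eq_neg_iff_add_eq_0)
  hence "(j / k)\<^sup>2 = -1" using assms by (simp add: power_divide)
  with minus_one_nonsquare show False by blast
qed

lemma kdelta_conv_quad_char:
  assumes k: "k \<noteq> (0::'k)"
  shows "kdelta j k - kdelta j (- k) = (if j\<^sup>2 = k\<^sup>2 then quad_char (j * k) else 0)"
proof -
  have kk: "quad_char (k * k) = 1" using quad_char_square[OF k] by (simp add: power2_eq_square)
  have "k \<noteq> - k"
    using two k by (metis add_eq_0_iff mult_2 mult_eq_0_iff)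
  thus ?thesis
    using kk by (auto simp: kdelta_def power2_eq_iff quad_char_minus)
qed

text \<open>
  The involution \<open>x \<mapsto> a/x\<close> changes the sign of every term, as \<open>\<phi>\<close> is odd. Hence the sum in \<open>P\<close>
  vanishes when \<open>j = 0\<close> or \<open>k = 0\<close>.
\<close>
lemma twisted_sum_eq_0:
  assumes a: "a \<noteq> 0"
  shows "(\<Sum>x\<in>UNIV - {0}. quad_char (a / x - x) * \<psi> (x * c + (a / x) * c)) = 0" (is "?S = 0")
proof -
  have "?S = (\<Sum>x\<in>UNIV - {0}. - (quad_char (a / x - x) * \<psi> (x * c + (a / x) * c)))"
  proof (rule sum.reindex_bij_witness[of _ "\<lambda>x. a / x" "\<lambda>x. a / x"])
    fix x assume "x \<in> UNIV - {0::'k}"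
    hence "a / (a / x) = x" using a by simp
    thus "- (quad_char (a / (a / x) - a / x) * \<psi> ((a / x) * c + (a / (a / x)) * c)) =
            quad_char (a / x - x) * \<psi> (x * c + (a / x) * c)"
      using quad_char_minus_commute[of x "a / x"] by (simp add: add.commute)
  qed (use a in auto)
  hence "?S = - ?S" by (simp add: sum_negf)
  thus ?thesis by simp
qed

end

theorem mainTheorem1:
  fixes p n :: nat
    and emb :: "'k::{finite,field} \<Rightarrow> 'K::{finite,field}"
    and M8 :: "'K \<Rightarrow> complex"
    and a :: 'k
    and s \<tau> :: complex
  assumes "prime p" and "odd p"
    and "CARD('k) = p ^ n" and "CARD('k) mod 4 = 3"
    and "CARD('K) = CARD('k) ^ 2" and "field_embedding emb"
    and "mult_char M8" and "mult_char_order M8 = 8"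
    and "a \<noteq> 0"
    and "s ^ 2 = of_nat (CARD('k)) * M8 (emb (- a))" and "\<tau> = - s"
  shows "\<forall>j k :: 'k. P_sum p n a j k = V_sum p n emb M8 \<tau> a j * V_sum p n emb M8 \<tau> a k"
proof (intro allI)
  fix j k :: 'k
  have "CHAR('k) = p" by (rule CHAR_finite_field[OF assms(1) assms(3)])
  have two: "(2::'k) \<noteq> 0"
  proof
    assume "(2::'k) = 0"
    hence "of_nat 2 = (0::'k)" by simp
    hence "p dvd 2" using \<open>CHAR('k) = p\<close> of_nat_eq_0_iff_char_dvd by metis
    with assms(1,2) show False by (metis primes_dvd_imp_eq two_is_prime_nat even_numeral)
  qed
  interpret additive_character "psi p n :: 'k \<Rightarrow> complex"
    by (rule additive_character_psi[OF assms(1) assms(3)])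
  interpret quadratic_extension "psi p n :: 'k \<Rightarrow> complex" p n emb M8
    by unfold_locales (use two assms in auto)
  let ?S = "\<Sum>x\<in>UNIV - {0}. quad_char (a / x - x) * psi p n (x * (j + k)\<^sup>2 + (a / x) * (j - k)\<^sup>2)"
  let ?q = "of_nat CARD('k) :: complex"
  have P: "P_sum p n a j k = kdelta j k - kdelta j (- k) + 1 / gauss * ?S"
    by (simp add: P_sum_def gauss_sum_def gauss_def quad_char_minus_one)
  have V: "V_sum p n emb M8 \<tau> a j = inverse \<tau> * quad_char j * norm_sum a j" for j
    by (simp add: V_sum_def norm_sum_def psi2_def tr_def frob_def emb_power)
  show "P_sum p n a j k = V_sum p n emb M8 \<tau> a j * V_sum p n emb M8 \<tau> a k"
  proof (cases "j = 0 \<or> k = 0")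
    case True
    hence "?S = 0" using twisted_sum_eq_0[OF \<open>a \<noteq> 0\<close>, of "j\<^sup>2"] twisted_sum_eq_0[OF \<open>a \<noteq> 0\<close>, of "k\<^sup>2"]
      by auto
    moreover have "kdelta j k = kdelta j (- k)" using True by (auto simp: kdelta_def)
    ultimately show ?thesis using True unfolding P V by auto
  next
    case False
    hence j: "j \<noteq> 0" and k: "k \<noteq> 0" by auto
    let ?W = "\<Sum>r\<in>UNIV. quad_char (2 * j * k + r) * kloosterman (a * ((j\<^sup>2 + k\<^sup>2)\<^sup>2 - r\<^sup>2))"
    let ?d = "if j\<^sup>2 = k\<^sup>2 then ?q else 0"
    have q: "?q \<noteq> 0" by (simp add: finite_UNIV_card_ge_0)
    have G2: "gauss * gauss = - ?q"
      using gauss_square by (simp add: quad_char_minus_one power2_eq_square)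
    hence "gauss \<noteq> 0" using q by auto
    hence "1 / gauss * ?S = (gauss * ?S) / (gauss * gauss)" by simp
    also have "\<dots> = - (?W / ?q)"
      unfolding gauss_times_twisted_sum[OF \<open>a \<noteq> 0\<close> sum_of_squares_nonzero[OF k]] G2 by simp
    finally have S: "1 / gauss * ?S = - (?W / ?q)" .
    have \<tau>2: "\<tau> * \<tau> = ?q * M8 (emb (- a))"
      using assms(10,11) by (simp add: power2_eq_square)
    have nz: "M8 (emb (- a)) \<noteq> 0"
      using \<open>a \<noteq> 0\<close> by (intro \<theta>_nonzero) simp
    have \<phi>2: "quad_char (j * k) * quad_char (j * k) = 1"
      using quad_char_power2[of "j * k"] j k by (simp add: power2_eq_square)
    have "V_sum p n emb M8 \<tau> a j * V_sum p n emb M8 \<tau> a k =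
            (quad_char j * quad_char k) * (norm_sum a j * norm_sum a k) / (\<tau> * \<tau>)"
      unfolding V by (simp add: divide_inverse)
    also have "\<dots> = quad_char (j * k) * (M8 (emb (- a)) * (?d - quad_char (j * k) * ?W)) / (?q * M8 (emb (- a)))"
      unfolding norm_sum_product_kloosterman[OF \<open>a \<noteq> 0\<close> j k] \<tau>2 quad_char_mult[OF two] ..
    also have "\<dots> = quad_char (j * k) * ?d / ?q - (quad_char (j * k) * quad_char (j * k)) * ?W / ?q"
      using nz by (simp add: diff_divide_distrib right_diff_distrib)
    also have "\<dots> = (kdelta j k - kdelta j (- k)) - ?W / ?q"
      unfolding \<phi>2 kdelta_conv_quad_char[OF k] using q by simp
    also have "\<dots> = P_sum p n a j k"
      unfolding P S by simp
    finally show ?thesis ..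
  qed
qed

end
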